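(* Let $X, X_1, X_2, \dots$ be i.i.d. real random variables with mean $\mu$, variance $\sigma^2>0$ and finite eighth moment. Let $\nu_k = E\left(\left(\frac{X-\mu}{\sigma}\right)^k\right)$ for $k\le 8$ denote the $k$-th reduced moment, let $\tau=\nu_3$ be the skewness and $\kappa=\nu_4$ the kurtosis of $X$, and put $\Delta=\kappa-\tau^2=\nu_4-\nu_3^2$. For $n\ge 1$ let $\bar X_n=\frac1n\sum_{i=1}^n X_i$ and $$T_n=\frac{\frac1n\sum_{i=1}^n (X_i-\bar X_n)^4}{\left[\frac1n\sum_{i=1}^n (X_i-\bar X_n)^2\right]^2}-\frac{\left[\frac1n\sum_{i=1}^n (X_i-\bar X_n)^3\right]^2}{\left[\frac1n\sum_{i=1}^n (X_i-\bar X_n)^2\right]^3}.$$ Then, as $n\to\infty$, $\sqrt n\,(T_n-\Delta)$ converges in distribution to $\mathcal N(0,\varsigma^2)$, where $$\varsigma^2 = 4\Delta^3-\Delta^2-\left(3\nu_3^4+16\nu_3^2-8\nu_3\nu_5+4\nu_6\right)\Delta+\nu_3^6-4\nu_3^4-4\nu_3^3\nu_5+2\nu_3^2\left(2+3\nu_6\right)+4\nu_3\left(\nu_5-\nu_7\right)+\nu_8 .$$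
   Context: $\mathcal N(0,\varsigma^2)$ is the normal distribution with mean $0$ and variance $\varsigma^2$; if $\varsigma^2=0$ it is the point mass at $0$. On the event that the empirical variance $\frac1n\sum_{i=1}^n (X_i-\bar X_n)^2$ vanishes (an event whose probability tends to $0$), $T_n$ is given an arbitrary fixed value. *)

theory Defs
  imports "HOL-Probability.Probability"
begin

text \<open>The parameter \<open>v\<close> is the variance, whereas \<^const>\<open>normal_density\<close> takes the standard
  deviation; the degenerate case is the point mass. Only \<open>v \<ge> 0\<close> is meaningful.\<close>

definition normal_law :: "real \<Rightarrow> real \<Rightarrow> real measure" where
  "normal_law m v =
     (if v = 0 then return borel m else density lborel (normal_density m (sqrt v)))"

text \<open>Samples are indexed from 1, so the value \<open>x 0\<close> is never used.\<close>

definition sample_mean :: "nat \<Rightarrow> (nat \<Rightarrow> real) \<Rightarrow> real" where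
  "sample_mean n x = (\<Sum>i=1..n. x i) / real n"

definition central_sample_moment :: "nat \<Rightarrow> nat \<Rightarrow> (nat \<Rightarrow> real) \<Rightarrow> real" where
  "central_sample_moment k n x = (\<Sum>i=1..n. (x i - sample_mean n x) ^ k) / real n"

text \<open>Empirical kurtosis minus squared empirical skewness; \<open>c\<close> is the value assigned to the
  statistic when the empirical variance vanishes.\<close>

definition T_stat :: "real \<Rightarrow> nat \<Rightarrow> (nat \<Rightarrow> real) \<Rightarrow> real" where
  "T_stat c n x =
     (if central_sample_moment 2 n x = 0 then c
      else central_sample_moment 4 n x / (central_sample_moment 2 n x) ^ 2
           - (central_sample_moment 3 n x) ^ 2 / (central_sample_moment 2 n x) ^ 3)"

end

theory Submission
  imports Defs
begin

text \<open>
  The proof is the delta method. The statistic is invariant under affine changes of the observations,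
  so they may be assumed standardised (lemma \<open>T_stat_affine_invariant\<close>). It is then a smooth function
  of the first four raw sample moments near the population moments \<open>(0, 1, \<nu> 3, \<nu> 4)\<close>, and
  \<open>T_n - \<Delta>\<close> equals a linear form in the deviations \<open>d\<close> of these moments, up to an error of at
  most \<open>C * norm d ^ 2\<close> on a ball around the origin (\<open>T_stat_expansion\<close>). The event that the
  empirical variance vanishes lies outside this ball, whatever value the statistic has there.

  The deviations are averages of independent centred variables with finite second moments (this
  is where the eighth moment enters), so the mean of \<open>norm d ^ 2\<close> is of order \<open>1 / n\<close>. Markov's
  inequality shows that both leaving the ball and the error multiplied by \<open>sqrt n\<close> are
  asymptotically negligible (\<open>sqrt_times_quadratic_remainder_vanishes\<close>). What remains is the linear
  form, which is an average of the independent, identically distributed variables \<open>h (Y i)\<close> with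
  \<open>h y = (y^4 - \<nu> 4) - 2 \<nu> 3 (y^3 - \<nu> 3) - (2 \<nu> 4 - 3 (\<nu> 3)^2) (y^2 - 1) + 2 \<nu> 3 y\<close>.
  Hence the one-dimensional central limit theorem suffices
  (\<open>central_limit_theorem_possibly_degenerate\<close>), and a Slutsky argument on characteristic functions
  transfers the limit to the statistic (\<open>weak_conv_m_asymptotically_equal\<close>).

  The limit variance is the second moment of \<open>h (Y 1)\<close>, so it is nonnegative; expanding the square
  yields the polynomial in the moments (\<open>T_stat_limit_variance\<close>).

  Expansions with quadratic error are handled by closure rules for sums, products and reciprocals
  instead of by second derivatives. The linear form is thereby computed together with the
  proof that it is the correct one.
\<close>

section \<open>Second-order expansions at the origin\<close>

text \<open>The expansion \<open>f x = a + l x + O(norm x ^ 2)\<close> at the origin. This is weaker than being twice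
  differentiable and has exactly the closure properties and the error bound that the delta method
  needs.\<close>

definition second_order_at_0 :: "('b::real_normed_vector \<Rightarrow> real) \<Rightarrow> real \<Rightarrow> ('b \<Rightarrow> real) \<Rightarrow> bool" where
  "second_order_at_0 f a l \<longleftrightarrow>
     bounded_linear l \<and> (\<lambda>x. f x - a - l x) \<in> O[nhds 0](\<lambda>x. (norm x)\<^sup>2)"

lemma bounded_linear_bigo_norm:
  fixes l :: "'b::real_normed_vector \<Rightarrow> real"
  assumes "bounded_linear l"
  shows "l \<in> O[nhds 0](norm)"
proof -
  obtain K where "\<And>x. norm (l x) \<le> norm x * K"
    using bounded_linear.bounded[OF assms] by blast
  then show ?thesis
    by (intro bigoI[where c = K]) (auto simp: mult.commute)
qed

lemma norm_bigo_1: "norm \<in> O[nhds (0::'b::real_normed_vector)](\<lambda>_. 1::real)"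
proof (rule bigoI[where c = 1])
  show "\<forall>\<^sub>F x in nhds (0::'b). norm (norm x) \<le> 1 * norm (1::real)"
    by (rule eventually_mono[OF eventually_nhds_ball[of 1]]) auto
qed

lemma second_order_at_0_bigo:
  assumes "second_order_at_0 f a l"
  shows "(\<lambda>x. f x - a) \<in> O[nhds 0](norm)" "f \<in> O[nhds 0](\<lambda>_. 1)" "l \<in> O[nhds 0](norm)"
    "(\<lambda>x. f x - a - l x) \<in> O[nhds 0](\<lambda>x. norm x * norm x)"
proof -
  show l: "l \<in> O[nhds 0](norm)"
    using assms by (simp add: second_order_at_0_def bounded_linear_bigo_norm)
  show r: "(\<lambda>x. f x - a - l x) \<in> O[nhds 0](\<lambda>x. norm x * norm x)"
    using assms by (simp add: second_order_at_0_def power2_eq_square)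
  have "(\<lambda>x::'a. norm x * norm x) \<in> O[nhds 0](\<lambda>x. norm x * 1)"
    by (intro landau_o.big.mult norm_bigo_1) simp
  then have "(\<lambda>x. (f x - a - l x) + l x) \<in> O[nhds 0](norm)"
    using r l by (intro sum_in_bigo(1)[OF landau_o.big.trans]) auto
  then show fa: "(\<lambda>x. f x - a) \<in> O[nhds 0](norm)" by simp
  have "(\<lambda>x. (f x - a) + a) \<in> O[nhds 0](\<lambda>_. 1)"
    by (intro sum_in_bigo(1)[OF landau_o.big.trans[OF fa norm_bigo_1]]) simp
  then show "f \<in> O[nhds 0](\<lambda>_. 1)" by simp
qed

lemma second_order_at_0_tendsto:
  assumes "second_order_at_0 f a l"
  shows "(f \<longlongrightarrow> a) (nhds 0)"
proof -
  obtain K where "\<forall>\<^sub>F x in nhds 0. norm (f x - a) \<le> K * norm (norm x)"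
    using second_order_at_0_bigo(1)[OF assms] by (auto elim: landau_o.bigE)
  moreover have "((\<lambda>x. K * norm (norm x)) \<longlongrightarrow> 0) (nhds (0::'a))"
    by (auto intro!: tendsto_eq_intros filterlim_ident)
  ultimately have "((\<lambda>x. f x - a) \<longlongrightarrow> 0) (nhds 0)"
    by (rule Lim_null_comparison)
  then show ?thesis by (simp add: LIM_zero_iff)
qed

lemma second_order_at_0_const: "second_order_at_0 (\<lambda>_. a) a (\<lambda>_. 0)"
  by (simp add: second_order_at_0_def bounded_linear_zero)

lemma second_order_at_0_shift:
  "bounded_linear l \<Longrightarrow> second_order_at_0 (\<lambda>x. a + l x) a l"
  by (simp add: second_order_at_0_def)

lemma second_order_at_0_add:
  assumes "second_order_at_0 f a l" "second_order_at_0 g b m"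
  shows "second_order_at_0 (\<lambda>x. f x + g x) (a + b) (\<lambda>x. l x + m x)"
proof -
  have "(\<lambda>x. (f x - a - l x) + (g x - b - m x)) \<in> O[nhds 0](\<lambda>x. (norm x)\<^sup>2)"
    using assms unfolding second_order_at_0_def by (intro sum_in_bigo(1)) blast+
  then show ?thesis
    using assms unfolding second_order_at_0_def
    by (auto intro: bounded_linear_add simp: algebra_simps)
qed

text \<open>The product rule. The error consists of the two remainders, each times a factor that stays
  bounded near the origin, and of the product \<open>l x * m x\<close> of the linear parts, which is itself
  of second order.\<close>

lemma second_order_at_0_mult:
  assumes "second_order_at_0 f a l" "second_order_at_0 g b m"
  shows "second_order_at_0 (\<lambda>x. f x * g x) (a * b) (\<lambda>x. a * m x + b * l x)"
proof -
  note F = second_order_at_0_bigo[OF assms(1)] and G = second_order_at_0_bigo[OF assms(2)]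
  have l1: "l \<in> O[nhds 0](\<lambda>_. 1)" using F(3) norm_bigo_1 by (rule landau_o.big.trans)
  have "(\<lambda>x. (f x - a - l x) * g x) \<in> O[nhds 0](\<lambda>x. (norm x * norm x) * 1)"
    by (intro landau_o.big.mult F G)
  moreover have "(\<lambda>x. (g x - b - m x) * (a + l x)) \<in> O[nhds 0](\<lambda>x. (norm x * norm x) * 1)"
    by (intro landau_o.big.mult G sum_in_bigo(1) l1) simp
  moreover have "(\<lambda>x. l x * m x) \<in> O[nhds 0](\<lambda>x. norm x * norm x)"
    by (intro landau_o.big.mult F G)
  ultimately have "(\<lambda>x. (f x - a - l x) * g x + (g x - b - m x) * (a + l x) + l x * m x)
      \<in> O[nhds 0](\<lambda>x. norm x * norm x)"
    by (intro sum_in_bigo) simp_all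
  moreover have "(f x - a - l x) * g x + (g x - b - m x) * (a + l x) + l x * m x
      = f x * g x - a * b - (a * m x + b * l x)" for x
    by (simp add: algebra_simps)
  ultimately have "(\<lambda>x. f x * g x - a * b - (a * m x + b * l x)) \<in> O[nhds 0](\<lambda>x. (norm x)\<^sup>2)"
    by (simp add: power2_eq_square)
  then show ?thesis
    using assms unfolding second_order_at_0_def
    by (auto intro!: bounded_linear_add bounded_linear_const_mult)
qed

lemma second_order_at_0_scale:
  "second_order_at_0 f a l \<Longrightarrow> second_order_at_0 (\<lambda>x. k * f x) (k * a) (\<lambda>x. k * l x)"
  using second_order_at_0_mult[OF second_order_at_0_const[of k]] by simp

text \<open>The error of the linearised reciprocal is
  \<open>(l x * (f x - a) - a * (f x - a - l x)) / (a ^ 2 * f x)\<close>. Its numerator is of second order, and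
  its denominator stays away from zero because \<open>f\<close> tends to \<open>a \<noteq> 0\<close>.\<close>

lemma second_order_at_0_inverse:
  assumes f: "second_order_at_0 f a l" and a: "a \<noteq> 0"
  shows "second_order_at_0 (\<lambda>x. inverse (f x)) (inverse a) (\<lambda>x. - l x / a\<^sup>2)"
proof -
  note F = second_order_at_0_bigo[OF f]
  have lim: "(f \<longlongrightarrow> a) (nhds 0)" using f by (rule second_order_at_0_tendsto)
  have "((\<lambda>x. inverse (a\<^sup>2 * f x)) \<longlongrightarrow> inverse (a\<^sup>2 * a)) (nhds 0)"
    using a by (intro tendsto_intros lim) auto
  then have inv1: "(\<lambda>x. inverse (a\<^sup>2 * f x)) \<in> O[nhds 0](\<lambda>_. 1)"
    by (intro bigoI_tendsto[where c = "inverse (a\<^sup>2 * a)"]) auto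
  have "(\<lambda>x. l x * (f x - a)) \<in> O[nhds 0](\<lambda>x. norm x * norm x)"
    by (intro landau_o.big.mult F)
  moreover have "(\<lambda>x. a * (f x - a - l x)) \<in> O[nhds 0](\<lambda>x. norm x * norm x)"
    using F(4) by simp
  ultimately have "(\<lambda>x. (l x * (f x - a) - a * (f x - a - l x)) * inverse (a\<^sup>2 * f x))
      \<in> O[nhds 0](\<lambda>x. (norm x * norm x) * 1)"
    by (rule landau_o.big.mult[OF sum_in_bigo(2) inv1])
  moreover have "\<forall>\<^sub>F x in nhds 0. (l x * (f x - a) - a * (f x - a - l x)) * inverse (a\<^sup>2 * f x)
      = inverse (f x) - inverse a - (- l x / a\<^sup>2)"
    using tendsto_imp_eventually_ne[OF lim a]
    by eventually_elim (use a in \<open>simp add: field_simps power2_eq_square\<close>)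
  ultimately have "(\<lambda>x. inverse (f x) - inverse a - (- l x / a\<^sup>2)) \<in> O[nhds 0](\<lambda>x. (norm x)\<^sup>2)"
    by (subst landau_o.big.in_cong[symmetric]) (auto simp: power2_eq_square)
  moreover have "bounded_linear (\<lambda>x. - l x / a\<^sup>2)"
    using f unfolding second_order_at_0_def
    by (intro bounded_linear_divide[THEN bounded_linear_compose] bounded_linear_minus) auto
  ultimately show ?thesis unfolding second_order_at_0_def by blast
qed

text \<open>The Landau symbol with its constants: an error bound valid on a whole ball, which can be used
  at every sample point at which the random vector falls into that ball.\<close>

lemma second_order_at_0_D:
  assumes "second_order_at_0 f a l"
  obtains \<delta> C where "\<delta> > 0" "C > 0"
    "\<And>x. norm x < \<delta> \<Longrightarrow> \<bar>f x - a - l x\<bar> \<le> C * (norm x)\<^sup>2"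
proof -
  obtain C where C: "C > 0" "\<forall>\<^sub>F x in nhds 0. norm (f x - a - l x) \<le> C * norm ((norm x)\<^sup>2)"
    using assms unfolding second_order_at_0_def by (auto elim: landau_o.bigE)
  then obtain \<delta> where "\<delta> > 0" "\<And>x. dist x 0 < \<delta> \<Longrightarrow> norm (f x - a - l x) \<le> C * norm ((norm x)\<^sup>2)"
    unfolding eventually_nhds_metric by blast
  with C(1) show ?thesis by (intro that[of \<delta> C]) auto
qed

section \<open>Negligible remainders\<close>

context prob_space begin

lemma identically_distributed_transfer:
  fixes U V :: "'a \<Rightarrow> real" and f :: "real \<Rightarrow> real"
  assumes [measurable]: "random_variable borel U" "random_variable borel V" "f \<in> borel_measurable borel"
    and "distr M borel U = distr M borel V"
  shows "integrable M (\<lambda>\<omega>. f (U \<omega>)) \<longleftrightarrow> integrable M (\<lambda>\<omega>. f (V \<omega>))"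
    and "expectation (\<lambda>\<omega>. f (U \<omega>)) = expectation (\<lambda>\<omega>. f (V \<omega>))"
  using assms(4) integral_distr[of U M borel f] integral_distr[of V M borel f]
    integrable_distr_eq[of U M borel f] integrable_distr_eq[of V M borel f]
  by auto

text \<open>Slutsky's theorem for sums, by characteristic functions: since \<open>s \<mapsto> exp (i * t * s)\<close> is
  bounded and Lipschitz, the characteristic functions of \<open>S n\<close> and \<open>U n\<close> at \<open>t\<close> differ by at most
  \<open>\<bar>t\<bar> * \<epsilon>\<close> plus twice the probability that \<open>S n\<close> and \<open>U n\<close> are at least \<open>\<epsilon>\<close> apart. Levy's
  continuity theorem turns this into weak convergence.\<close>

lemma weak_conv_m_asymptotically_equal:
  fixes S U :: "nat \<Rightarrow> 'a \<Rightarrow> real"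
  assumes [measurable]: "\<And>n. random_variable borel (S n)" "\<And>n. random_variable borel (U n)"
    and D: "real_distribution D"
    and conv: "weak_conv_m (\<lambda>n. distr M borel (U n)) D"
    and diff: "\<And>\<epsilon>. \<epsilon> > 0 \<Longrightarrow> (\<lambda>n. prob {\<omega>\<in>space M. \<epsilon> \<le> \<bar>S n \<omega> - U n \<omega>\<bar>}) \<longlonglongrightarrow> 0"
  shows "weak_conv_m (\<lambda>n. distr M borel (S n)) D"
proof (rule levy_continuity[OF _ D])
  have distrD: "real_distribution (distr M borel V)" if "random_variable borel V" for V
    using that by (simp add: real_distribution_distr)
  show "real_distribution (distr M borel (S n))" for n
    by (rule distrD) simp
  fix t :: real
  have charU: "(\<lambda>n. char (distr M borel (U n)) t) \<longlonglongrightarrow> char D t"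
    by (intro levy_continuity1 D conv distrD) simp
  have bound: "norm (char (distr M borel (S n)) t - char (distr M borel (U n)) t)
      \<le> \<bar>t\<bar> * \<epsilon> + 2 * prob {\<omega>\<in>space M. \<epsilon> \<le> \<bar>S n \<omega> - U n \<omega>\<bar>}" if "\<epsilon> > 0" for n \<epsilon>
  proof -
    let ?A = "{\<omega>\<in>space M. \<epsilon> \<le> \<bar>S n \<omega> - U n \<omega>\<bar>}"
    have int: "integrable M (\<lambda>\<omega>. iexp (t * V \<omega>))" if [measurable]: "random_variable borel V" for V
      by (rule integrable_iexp) auto
    have pointwise: "norm (iexp (t * S n \<omega>) - iexp (t * U n \<omega>)) \<le> \<bar>t\<bar> * \<epsilon> + 2 * indicator ?A \<omega>"
      if "\<omega> \<in> space M" for \<omega>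
    proof -
      have "norm (iexp (t * S n \<omega>) - iexp (t * U n \<omega>))
          = norm (iexp (t * U n \<omega>) * (iexp (t * (S n \<omega> - U n \<omega>)) - 1))"
        by (simp add: algebra_simps flip: exp_add)
      also have "\<dots> = norm (iexp (t * (S n \<omega> - U n \<omega>)) - 1)"
        by (simp only: norm_mult norm_exp_i_times mult_1_left)
      finally have eq: "norm (iexp (t * S n \<omega>) - iexp (t * U n \<omega>)) = norm (iexp (t * (S n \<omega> - U n \<omega>)) - 1)" .
      show ?thesis
      proof (cases "\<omega> \<in> ?A")
        case True
        have "norm (iexp (t * (S n \<omega> - U n \<omega>)) - 1) \<le> 2"
          using norm_triangle_ineq4[of "iexp (t * (S n \<omega> - U n \<omega>))" 1]
          by (simp only: norm_exp_i_times norm_one)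
        moreover have "0 \<le> \<bar>t\<bar> * \<epsilon>" using \<open>\<epsilon> > 0\<close> by simp
        ultimately show ?thesis using True unfolding eq by simp
      next
        case False
        have "norm (iexp (t * (S n \<omega> - U n \<omega>)) - 1) \<le> \<bar>t * (S n \<omega> - U n \<omega>)\<bar>"
          using iexp_approx1[of "t * (S n \<omega> - U n \<omega>)" 0] by simp
        also have "\<dots> \<le> \<bar>t\<bar> * \<epsilon>"
          using False that by (auto simp: abs_mult intro!: mult_left_mono)
        finally show ?thesis using eq False by simp
      qed
    qed
    have ind: "integrable M (indicator ?A :: 'a \<Rightarrow> real)"
      by (intro integrable_real_indicator) (auto simp: less_top[symmetric])
    have "norm (char (distr M borel (S n)) t - char (distr M borel (U n)) t)
        = norm (CLINT \<omega>|M. iexp (t * S n \<omega>) - iexp (t * U n \<omega>))"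
      using int[of "S n"] int[of "U n"] by (simp add: char_def integral_distr)
    also have "\<dots> \<le> (\<integral>\<omega>. norm (iexp (t * S n \<omega>) - iexp (t * U n \<omega>)) \<partial>M)"
      by (rule integral_norm_bound)
    also have "\<dots> \<le> (\<integral>\<omega>. \<bar>t\<bar> * \<epsilon> + 2 * indicator ?A \<omega> \<partial>M)"
      by (intro integral_mono integrable_norm Bochner_Integration.integrable_diff int pointwise)
         (auto intro!: Bochner_Integration.integrable_add integrable_mult_right ind)
    also have "\<dots> = \<bar>t\<bar> * \<epsilon> + 2 * prob ?A"
      by (subst Bochner_Integration.integral_add) (simp_all add: prob_space ind sets.Int_space_eq2)
    finally show ?thesis .
  qed
  have "(\<lambda>n. norm (char (distr M borel (S n)) t - char (distr M borel (U n)) t)) \<longlonglongrightarrow> 0"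
  proof (rule tendstoI)
    fix e :: real assume "e > 0"
    \<comment> \<open>With this \<open>\<epsilon>\<close> the Lipschitz part of the bound is at most \<open>e / 2\<close>; adding 1 covers \<open>t = 0\<close>.\<close>
    define \<epsilon> where "\<epsilon> = e / (2 * (\<bar>t\<bar> + 1))"
    have \<epsilon>: "\<epsilon> > 0" "\<bar>t\<bar> * \<epsilon> \<le> e / 2"
      using \<open>e > 0\<close> by (auto simp: \<epsilon>_def field_simps add_pos_nonneg)
    have "\<forall>\<^sub>F n in sequentially. prob {\<omega>\<in>space M. \<epsilon> \<le> \<bar>S n \<omega> - U n \<omega>\<bar>} < e / 4"
      using diff[OF \<epsilon>(1)] \<open>e > 0\<close> by (intro order_tendstoD) auto
    then show "\<forall>\<^sub>F n in sequentially.
        dist (norm (char (distr M borel (S n)) t - char (distr M borel (U n)) t)) 0 < e"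
    proof eventually_elim
      case (elim n)
      then show ?case using bound[OF \<epsilon>(1), of n] \<epsilon>(2) by simp
    qed
  qed
  then have "(\<lambda>n. char (distr M borel (S n)) t - char (distr M borel (U n)) t) \<longlonglongrightarrow> 0"
    by (rule tendsto_norm_zero_cancel)
  from tendsto_add[OF this charU] show "(\<lambda>n. char (distr M borel (S n)) t) \<longlonglongrightarrow> char D t"
    by simp
qed

text \<open>Why second-order errors do not matter in the delta method: if \<open>d n\<close> has mean square of order
  \<open>1 / n\<close>, then \<open>sqrt n * norm (d n) ^ 2\<close> has mean of order \<open>1 / sqrt n\<close>, so it vanishes in
  probability by Markov's inequality. The bound on \<open>r n\<close> is required only where \<open>d n\<close> is small; the
  exceptional event, on which \<open>r n\<close> may be arbitrarily large, has probability of order \<open>1 / n\<close>.\<close>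

lemma sqrt_times_quadratic_remainder_vanishes:
  fixes d :: "nat \<Rightarrow> 'a \<Rightarrow> 'b::real_normed_vector" and r :: "nat \<Rightarrow> 'a \<Rightarrow> real"
  assumes r[measurable]: "\<And>n. random_variable borel (r n)"
    and d: "\<And>n. integrable M (\<lambda>\<omega>. (norm (d n \<omega>))\<^sup>2)"
    and K: "\<And>n. 1 \<le> n \<Longrightarrow> expectation (\<lambda>\<omega>. (norm (d n \<omega>))\<^sup>2) \<le> K / real n"
    and \<delta>: "\<delta> > 0" and C: "C > 0"
    and quad: "\<And>n \<omega>. 1 \<le> n \<Longrightarrow> \<omega> \<in> space M \<Longrightarrow> norm (d n \<omega>) < \<delta> \<Longrightarrow> \<bar>r n \<omega>\<bar> \<le> C * (norm (d n \<omega>))\<^sup>2"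
    and \<epsilon>: "\<epsilon> > 0"
  shows "(\<lambda>n. prob {\<omega>\<in>space M. \<epsilon> \<le> \<bar>sqrt (real n) * r n \<omega>\<bar>}) \<longlonglongrightarrow> 0"
proof (rule Lim_null_comparison)
  have [measurable]: "(\<lambda>\<omega>. (norm (d n \<omega>))\<^sup>2) \<in> borel_measurable M" for n
    using d by (rule borel_measurable_integrable)
  show "\<forall>\<^sub>F n in sequentially. norm (prob {\<omega>\<in>space M. \<epsilon> \<le> \<bar>sqrt (real n) * r n \<omega>\<bar>})
      \<le> K / \<delta>\<^sup>2 / real n + C * K / \<epsilon> / sqrt (real n)"
    using eventually_ge_at_top[of 1]
  proof eventually_elim
    case (elim n)
    let ?A = "{\<omega>\<in>space M. \<delta>\<^sup>2 \<le> (norm (d n \<omega>))\<^sup>2}"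
    let ?c = "\<epsilon> / (C * sqrt (real n))"
    let ?B = "{\<omega>\<in>space M. ?c \<le> (norm (d n \<omega>))\<^sup>2}"
    have n: "sqrt (real n) > 0" using elim by simp
    have c: "?c > 0" using n \<epsilon> C by simp
    have "{\<omega>\<in>space M. \<epsilon> \<le> \<bar>sqrt (real n) * r n \<omega>\<bar>} \<subseteq> ?A \<union> ?B"
    proof safe
      fix \<omega> assume \<omega>: "\<omega> \<in> space M" "\<epsilon> \<le> \<bar>sqrt (real n) * r n \<omega>\<bar>" "\<not> ?c \<le> (norm (d n \<omega>))\<^sup>2"
      show "\<delta>\<^sup>2 \<le> (norm (d n \<omega>))\<^sup>2"
      proof (rule ccontr)
        assume "\<not> ?thesis"
        then have "norm (d n \<omega>) < \<delta>"
          using \<delta> by (metis less_imp_le linorder_not_le norm_ge_zero power_mono)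
        then have "\<bar>sqrt (real n) * r n \<omega>\<bar> \<le> sqrt (real n) * (C * (norm (d n \<omega>))\<^sup>2)"
          using quad[OF elim \<omega>(1)] by (simp add: abs_mult mult_left_mono)
        also have "\<dots> < \<epsilon>"
          using \<omega>(3) n C by (simp add: field_simps)
        finally show False using \<omega>(2) by simp
      qed
    qed
    then have "prob {\<omega>\<in>space M. \<epsilon> \<le> \<bar>sqrt (real n) * r n \<omega>\<bar>} \<le> prob (?A \<union> ?B)"
      by (intro finite_measure_mono) auto
    also have "\<dots> \<le> prob ?A + prob ?B"
      by (intro measure_Un_le) auto
    also have "prob ?A \<le> expectation (\<lambda>\<omega>. (norm (d n \<omega>))\<^sup>2) / \<delta>\<^sup>2"
      using \<delta> by (intro integral_Markov_inequality_measure[where A = "{}"] d) auto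
    also have "\<dots> \<le> K / real n / \<delta>\<^sup>2"
      by (intro divide_right_mono K elim) auto
    also have "prob ?B \<le> expectation (\<lambda>\<omega>. (norm (d n \<omega>))\<^sup>2) / ?c"
      using c by (intro integral_Markov_inequality_measure[where A = "{}"] d) auto
    also have "\<dots> \<le> K / real n / ?c"
      using c by (intro divide_right_mono K elim) auto
    also have "K / real n / ?c = C * K / \<epsilon> / sqrt (real n)"
    proof -
      have "real n = sqrt (real n) * sqrt (real n)" by simp
      then show ?thesis using n \<epsilon> C by (simp add: field_simps)
    qed
    finally show ?case by (simp add: field_simps)
  qed
  have "(\<lambda>n. K / \<delta>\<^sup>2 / real n + C * K / \<epsilon> / sqrt (real n)) \<longlonglongrightarrow> 0 + 0"
    by (intro tendsto_add tendsto_divide_0[OF tendsto_const] filterlim_at_top_imp_at_infinity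
        filterlim_real_sequentially filterlim_compose[OF sqrt_at_top filterlim_real_sequentially])
  then show "(\<lambda>n. K / \<delta>\<^sup>2 / real n + C * K / \<epsilon> / sqrt (real n)) \<longlonglongrightarrow> 0" by simp
qed

lemma integrable_power_le:
  fixes X :: "'a \<Rightarrow> real"
  assumes [measurable]: "random_variable borel X" and m: "integrable M (\<lambda>\<omega>. X \<omega> ^ m)" and "k \<le> m"
  shows "integrable M (\<lambda>\<omega>. X \<omega> ^ k)"
proof (rule Bochner_Integration.integrable_bound)
  show "integrable M (\<lambda>\<omega>. 1 + \<bar>X \<omega> ^ m\<bar>)"
    using m by (intro Bochner_Integration.integrable_add integrable_abs) simp_all
  have "\<bar>x\<bar> ^ k \<le> 1 + \<bar>x\<bar> ^ m" for x :: real
  proof (cases "\<bar>x\<bar> \<le> 1")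
    case True
    then have "\<bar>x\<bar> ^ k \<le> 1" by (simp add: power_le_one)
    then show ?thesis by (simp add: add_increasing2)
  next
    case False
    then have "\<bar>x\<bar> ^ k \<le> \<bar>x\<bar> ^ m" using \<open>k \<le> m\<close> by (intro power_increasing) auto
    then show ?thesis by simp
  qed
  then show "AE \<omega> in M. norm (X \<omega> ^ k) \<le> norm (1 + \<bar>X \<omega> ^ m\<bar>)"
    by (auto simp: power_abs)
qed simp

text \<open>Independence and centering make the mixed products of the summands integrate to zero.\<close>

lemma indep_sum_second_moment:
  fixes W :: "'i \<Rightarrow> 'a \<Rightarrow> real"
  assumes "finite I" "indep_vars (\<lambda>_. borel) W I"
    and "\<And>i. i \<in> I \<Longrightarrow> integrable M (\<lambda>\<omega>. (W i \<omega>)\<^sup>2)"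
    and "\<And>i. i \<in> I \<Longrightarrow> expectation (W i) = 0"
  shows "integrable M (\<lambda>\<omega>. (\<Sum>i\<in>I. W i \<omega>)\<^sup>2)"
    and "expectation (\<lambda>\<omega>. (\<Sum>i\<in>I. W i \<omega>)\<^sup>2) = (\<Sum>i\<in>I. expectation (\<lambda>\<omega>. (W i \<omega>)\<^sup>2))"
proof -
  have "integrable M (\<lambda>\<omega>. (\<Sum>i\<in>I. W i \<omega>)\<^sup>2) \<and>
      expectation (\<lambda>\<omega>. (\<Sum>i\<in>I. W i \<omega>)\<^sup>2) = (\<Sum>i\<in>I. expectation (\<lambda>\<omega>. (W i \<omega>)\<^sup>2))"
    using assms
  proof (induction I rule: finite_induct)
    case empty
    then show ?case by simp
  next
    case (insert i I)
    let ?S = "\<lambda>\<omega>. \<Sum>j\<in>I. W j \<omega>"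
    have rv: "random_variable borel (W j)" if "j \<in> insert i I" for j
      using insert.prems(1) that unfolding indep_vars_def2 by blast
    have int: "integrable M (W j)" if "j \<in> insert i I" for j
      using rv[OF that] insert.prems(2)[OF that] by (rule square_integrable_imp_integrable)
    have IH: "integrable M (\<lambda>\<omega>. (?S \<omega>)\<^sup>2)"
      "expectation (\<lambda>\<omega>. (?S \<omega>)\<^sup>2) = (\<Sum>i\<in>I. expectation (\<lambda>\<omega>. (W i \<omega>)\<^sup>2))"
      using insert.IH insert.prems indep_vars_subset[OF insert.prems(1)] by auto
    have ind: "indep_var borel (W i) borel ?S"
      using insert.hyps insert.prems(1) by (rule indep_vars_sum)
    have S: "integrable M ?S" using int by auto
    have cross: "integrable M (\<lambda>\<omega>. W i \<omega> * ?S \<omega>)" "expectation (\<lambda>\<omega>. W i \<omega> * ?S \<omega>) = 0"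
      using indep_var_integrable[OF ind int S] indep_var_lebesgue_integral[OF ind int S]
        insert.prems(3)[of i] by auto
    have eq: "(\<lambda>\<omega>. (\<Sum>j\<in>insert i I. W j \<omega>)\<^sup>2)
        = (\<lambda>\<omega>. (W i \<omega>)\<^sup>2 + (2 * (W i \<omega> * ?S \<omega>) + (?S \<omega>)\<^sup>2))"
      using insert.hyps by (auto simp: power2_eq_square algebra_simps)
    show ?case
      unfolding eq using insert.hyps insert.prems(2)[of i] IH cross by simp
  qed
  then show "integrable M (\<lambda>\<omega>. (\<Sum>i\<in>I. W i \<omega>)\<^sup>2)"
    "expectation (\<lambda>\<omega>. (\<Sum>i\<in>I. W i \<omega>)\<^sup>2) = (\<Sum>i\<in>I. expectation (\<lambda>\<omega>. (W i \<omega>)\<^sup>2))" by auto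
qed

end

section \<open>The central limit theorem with a possibly degenerate limit\<close>

lemma real_distribution_normal_law:
  assumes "0 \<le> v"
  shows "real_distribution (normal_law m v)"
  using assms
  by (auto simp: normal_law_def real_distribution_def real_distribution_axioms_def
      intro: prob_space_return prob_space_normal_density)

lemma normal_law_scaled_std_normal:
  assumes "0 < s"
  shows "normal_law 0 (s\<^sup>2) = distr std_normal_distribution borel (\<lambda>x. s * x)"
proof -
  interpret prob_space std_normal_distribution
    by (rule prob_space_normal_density) simp
  have "distributed std_normal_distribution lborel (\<lambda>x. x) std_normal_density"
    by (simp add: distributed_def distr_id2)
  from normal_density_affine[OF this, of s 0] assms
  have "distr std_normal_distribution lborel (\<lambda>x. s * x) = density lborel (normal_density 0 s)"
    by (simp add: distributed_def)
  then show ?thesis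
    using assms by (simp add: normal_law_def cong: distr_cong)
qed

lemma char_scaled_distr:
  assumes [measurable]: "f \<in> borel_measurable M"
  shows "char (distr M borel (\<lambda>x. s * f x)) t = char (distr M borel f) (t * s)"
  by (simp add: char_def integral_distr mult.assoc)

text \<open>For \<open>v > 0\<close> this is the classical central limit theorem, shifted to the index set \<open>{1..}\<close> and
  rescaled by \<open>sqrt v\<close>, the rescaling being done on characteristic functions. The case \<open>v = 0\<close> is
  included because the limit variance of the statistic can vanish, for instance when the
  observations take only two values.\<close>

lemma (in prob_space) central_limit_theorem_possibly_degenerate:
  fixes Z :: "nat \<Rightarrow> 'a \<Rightarrow> real"
  assumes indep: "indep_vars (\<lambda>_. borel) Z {1..}"
    and ident: "\<And>i. 1 \<le> i \<Longrightarrow> distr M borel (Z i) = distr M borel (Z 1)"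
    and sq: "integrable M (\<lambda>\<omega>. (Z 1 \<omega>)\<^sup>2)"
    and mean: "expectation (Z 1) = 0"
  defines "v \<equiv> expectation (\<lambda>\<omega>. (Z 1 \<omega>)\<^sup>2)"
  shows "weak_conv_m (\<lambda>n. distr M borel (\<lambda>\<omega>. (\<Sum>i=1..n. Z i \<omega>) / sqrt (real n))) (normal_law 0 v)"
proof (rule levy_continuity)
  have rv[measurable]: "random_variable borel (Z i)" if "1 \<le> i" for i
    using indep that unfolding indep_vars_def2 by auto
  have [measurable]: "random_variable borel (Z (Suc i))" "random_variable borel (Z (Suc 0))" for i
    by (auto intro: rv)
  have S_rv[measurable]: "random_variable borel (\<lambda>\<omega>. (\<Sum>i=1..n. Z i \<omega>) / sqrt (real n))" for n
    by (intro borel_measurable_divide borel_measurable_sum rv) auto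
  have v: "0 \<le> v" by (simp add: v_def)
  then show D: "real_distribution (normal_law 0 v)" by (rule real_distribution_normal_law)
  show "real_distribution (distr M borel (\<lambda>\<omega>. (\<Sum>i=1..n. Z i \<omega>) / sqrt (real n)))" for n
    by (rule real_distribution_distr) simp
  have transfer: "integrable M (\<lambda>\<omega>. f (Z i \<omega>)) \<longleftrightarrow> integrable M (\<lambda>\<omega>. f (Z 1 \<omega>))"
      "expectation (\<lambda>\<omega>. f (Z i \<omega>)) = expectation (\<lambda>\<omega>. f (Z 1 \<omega>))"
    if "1 \<le> i" and [measurable]: "f \<in> borel_measurable borel" for f :: "real \<Rightarrow> real" and i
    using identically_distributed_transfer[OF rv[OF that(1)] rv[of 1] that(2) ident[OF that(1)]] by simp_all
  fix t
  show "(\<lambda>n. char (distr M borel (\<lambda>\<omega>. (\<Sum>i=1..n. Z i \<omega>) / sqrt (real n))) t) \<longlonglongrightarrow> char (normal_law 0 v) t"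
  proof (cases "v = 0")
    case True
    \<comment> \<open>Every summand vanishes almost surely, and so does every normalised sum.\<close>
    have "AE \<omega> in M. Z i \<omega> = 0" if "1 \<le> i" for i
    proof -
      have "integrable M (\<lambda>\<omega>. (Z i \<omega>)\<^sup>2)" "expectation (\<lambda>\<omega>. (Z i \<omega>)\<^sup>2) = 0"
        using transfer[OF that, of "\<lambda>x. x\<^sup>2"] sq True by (auto simp: v_def)
      then show ?thesis by (subst (asm) integral_nonneg_eq_0_iff_AE) auto
    qed
    then have "AE \<omega> in M. \<forall>i\<in>{1..}. Z i \<omega> = 0" by (subst AE_ball_countable) auto
    then have zero: "AE \<omega> in M. (\<Sum>i=1..n. Z i \<omega>) / sqrt (real n) = 0" for n
      by eventually_elim auto
    have "(CLINT \<omega>|M. iexp (t * ((\<Sum>i=1..n. Z i \<omega>) / sqrt (real n)))) = (CLINT \<omega>|M. 1)" for n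
    proof (intro integral_cong_AE)
      show "AE \<omega> in M. iexp (t * ((\<Sum>i=1..n. Z i \<omega>) / sqrt (real n))) = 1"
        using zero[of n] by eventually_elim (simp only: mult_zero_right of_real_0 exp_zero)
    qed auto
    then have "char (distr M borel (\<lambda>\<omega>. (\<Sum>i=1..n. Z i \<omega>) / sqrt (real n))) t = 1" for n
      unfolding char_def by (subst integral_distr) (auto simp: prob_space)
    then show ?thesis
      using True by (simp add: normal_law_def char_def integral_return prob_space)
  next
    case False
    define s where "s = sqrt v"
    have s: "s > 0" "s\<^sup>2 = v" using v False by (auto simp: s_def)
    define S where "S n \<omega> = (\<Sum>i<n. Z (Suc i) \<omega>) / sqrt (real n * s\<^sup>2)" for n \<omega>
    have [measurable]: "random_variable borel (S n)" for n by (simp add: S_def[abs_def])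
    have "weak_conv_m (\<lambda>n. distr M borel (S n)) std_normal_distribution"
      unfolding S_def[abs_def]
    proof (rule central_limit_theorem_zero_mean)
      show "indep_vars (\<lambda>i. borel) (\<lambda>i. Z (Suc i)) UNIV"
      proof -
        have "indep_vars (\<lambda>j. PiM {Suc j} (\<lambda>_. borel)) (\<lambda>j \<omega>. restrict (\<lambda>i. Z i \<omega>) {Suc j}) UNIV"
          by (rule indep_vars_restrict[OF indep]) (auto simp: disjoint_family_on_def)
        from indep_vars_compose2[OF this, of "\<lambda>j f. f (Suc j)" "\<lambda>_. borel"]
        show ?thesis by (simp add: measurable_component_singleton)
      qed
      show m: "expectation (Z (Suc n)) = 0" for n using transfer(2)[of "Suc n" "\<lambda>x. x"] mean by simp
      show "variance (Z (Suc n)) = s\<^sup>2" for n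
        unfolding m using transfer(2)[of "Suc n" "\<lambda>x. x\<^sup>2"] s by (simp add: v_def)
      show "integrable M (\<lambda>\<omega>. (Z (Suc n) \<omega>)\<^sup>2)" for n using transfer(1)[of "Suc n" "\<lambda>x. x\<^sup>2"] sq by simp
      show "distr M borel (Z (Suc n)) = distr M borel (Z 1)" for n by (rule ident) simp
    qed (use s in auto)
    then have "(\<lambda>n. char (distr M borel (S n)) (t * s)) \<longlonglongrightarrow> char std_normal_distribution (t * s)"
      by (intro levy_continuity1 real_distribution_distr real_dist_normal_dist) auto
    moreover have "(\<lambda>\<omega>. (\<Sum>i=1..n. Z i \<omega>) / sqrt (real n)) = (\<lambda>\<omega>. s * S n \<omega>)" for n
      using s(1) by (simp add: S_def[abs_def] real_sqrt_mult sum.shift_bounds_Suc_ivl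
          sum.atLeast1_atMost_eq fun_eq_iff)
    moreover have "char (normal_law 0 v) t = char std_normal_distribution (t * s)"
      using char_scaled_distr[of "\<lambda>x. x" std_normal_distribution s t] s
      by (simp add: normal_law_scaled_std_normal distr_id2 flip: s(2))
    ultimately show ?thesis by (simp add: char_scaled_distr)
  qed
qed

section \<open>Linearisation of the statistic\<close>

lemma sample_mean_affine:
  assumes "1 \<le> n" "\<And>i. x i = \<mu> + \<sigma> * y i"
  shows "sample_mean n x = \<mu> + \<sigma> * sample_mean n y"
  using assms by (simp add: sample_mean_def sum.distrib field_simps flip: sum_distrib_left)

lemma central_sample_moment_affine:
  assumes "1 \<le> n" "\<And>i. x i = \<mu> + \<sigma> * y i"
  shows "central_sample_moment k n x = \<sigma> ^ k * central_sample_moment k n y"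
proof -
  have "(x i - sample_mean n x) ^ k = \<sigma> ^ k * (y i - sample_mean n y) ^ k" for i
    unfolding sample_mean_affine[of n x \<mu> \<sigma> y, OF assms] assms(2)
    by (simp flip: right_diff_distrib power_mult_distrib)
  then show ?thesis by (simp add: central_sample_moment_def flip: sum_distrib_left)
qed

text \<open>Numerator and denominator of both quotients scale by the same power of \<open>\<sigma>\<close>, the fourth and the
  sixth respectively. This reduces the problem to standardised observations.\<close>

lemma T_stat_affine_invariant:
  assumes "1 \<le> n" "\<sigma> \<noteq> 0" "\<And>i. x i = \<mu> + \<sigma> * y i"
  shows "T_stat c n x = T_stat c n y"
  using assms(2)
  by (simp add: T_stat_def central_sample_moment_affine[OF assms(1,3)] power_mult_distrib
      flip: power_mult)

definition raw_sample_moment :: "nat \<Rightarrow> nat \<Rightarrow> (nat \<Rightarrow> real) \<Rightarrow> real" where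
  "raw_sample_moment k n x = (\<Sum>i=1..n. x i ^ k) / real n"

text \<open>The right-hand sides are written with sums, products and scalings only, so that they match the
  closure rules for second-order expansions.\<close>

lemma central_sample_moment_via_raw:
  fixes x :: "nat \<Rightarrow> real"
  assumes "1 \<le> n"
  defines "m k \<equiv> raw_sample_moment k n x"
  shows "central_sample_moment 2 n x = m 2 - m 1 * m 1"
    and "central_sample_moment 3 n x = m 3 + -3 * (m 1 * m 2) + 2 * (m 1 * (m 1 * m 1))"
    and "central_sample_moment 4 n x
      = m 4 + -4 * (m 1 * m 3) + 6 * ((m 1 * m 1) * m 2) + -3 * ((m 1 * m 1) * (m 1 * m 1))"
proof -
  have mean: "sample_mean n x = m 1"
    by (simp add: sample_mean_def m_def raw_sample_moment_def)
  have m: "(\<Sum>i=1..n. x i ^ k) = real n * m k" for k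
    using assms(1) by (simp add: m_def raw_sample_moment_def)
  have m1: "(\<Sum>i=1..n. x i) = real n * m 1" using m[of 1] by simp
  have n: "real n \<noteq> 0" using assms(1) by simp
  let ?a = "m 1"
  have "(\<Sum>i=1..n. (x i - ?a) ^ 2) = (\<Sum>i=1..n. x i ^ 2 - (2 * ?a) * x i + ?a ^ 2)"
    by (intro sum.cong) (auto simp: power2_eq_square algebra_simps)
  also have "\<dots> = real n * (m 2 - ?a * ?a)"
    unfolding sum.distrib sum_subtractf sum_distrib_left[symmetric] m m1
    by (simp add: power2_eq_square algebra_simps)
  finally show "central_sample_moment 2 n x = m 2 - m 1 * m 1"
    using n by (simp add: central_sample_moment_def mean)
  have "(\<Sum>i=1..n. (x i - ?a) ^ 3) = (\<Sum>i=1..n. x i ^ 3 - (3 * ?a) * x i ^ 2 + (3 * ?a ^ 2) * x i - ?a ^ 3)"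
    by (intro sum.cong) (auto simp: power2_eq_square power3_eq_cube algebra_simps)
  also have "\<dots> = real n * (m 3 + -3 * (?a * m 2) + 2 * (?a * (?a * ?a)))"
    unfolding sum.distrib sum_subtractf sum_distrib_left[symmetric] m m1
    by (simp add: power2_eq_square power3_eq_cube algebra_simps)
  finally show "central_sample_moment 3 n x = m 3 + -3 * (m 1 * m 2) + 2 * (m 1 * (m 1 * m 1))"
    using n by (simp add: central_sample_moment_def mean)
  have "(\<Sum>i=1..n. (x i - ?a) ^ 4)
      = (\<Sum>i=1..n. x i ^ 4 - (4 * ?a) * x i ^ 3 + (6 * ?a ^ 2) * x i ^ 2 - (4 * ?a ^ 3) * x i + ?a ^ 4)"
    by (intro sum.cong) (auto simp: power2_eq_square power3_eq_cube power4_eq_xxxx algebra_simps)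
  also have "\<dots> = real n * (m 4 + -4 * (?a * m 3) + 6 * ((?a * ?a) * m 2) + -3 * ((?a * ?a) * (?a * ?a)))"
    unfolding sum.distrib sum_subtractf sum_distrib_left[symmetric] m m1
    by (simp add: power2_eq_square power3_eq_cube power4_eq_xxxx algebra_simps)
  finally show "central_sample_moment 4 n x
      = m 4 + -4 * (m 1 * m 3) + 6 * ((m 1 * m 1) * m 2) + -3 * ((m 1 * m 1) * (m 1 * m 1))"
    using n by (simp add: central_sample_moment_def mean)
qed

text \<open>The linearisation of the statistic at the population moments \<open>(0, 1, a, \<kappa>)\<close>. Near that point
  the empirical variance \<open>V\<close> is nonzero and the statistic is given by the two quotients, which makes
  the bound uniform in \<open>c\<close>. To first order, \<open>V\<close> changes by \<open>d2\<close>, the third central moment by \<open>d3 - 3 * d1\<close> and the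
  fourth by \<open>d4 - 4 * a * d1\<close>; the quotient rule then gives the stated linear form.\<close>

lemma T_stat_expansion:
  fixes a \<kappa> :: real
  defines "b \<equiv> 2 * \<kappa> - 3 * a\<^sup>2"
  obtains \<delta> C where "\<delta> > 0" "C > 0"
    "\<And>c n x d1 d2 d3 d4. 1 \<le> n \<Longrightarrow> norm (d1, d2, d3, d4) < \<delta> \<Longrightarrow>
      raw_sample_moment 1 n x = d1 \<Longrightarrow> raw_sample_moment 2 n x = 1 + d2 \<Longrightarrow>
      raw_sample_moment 3 n x = a + d3 \<Longrightarrow> raw_sample_moment 4 n x = \<kappa> + d4 \<Longrightarrow>
      \<bar>T_stat c n x - (\<kappa> - a\<^sup>2) - (d4 - 2 * a * d3 - b * d2 + 2 * a * d1)\<bar>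
        \<le> C * (norm (d1, d2, d3, d4))\<^sup>2"
proof -
  \<comment> \<open>The raw moments as functions of their deviations; the summand 0 gives \<open>m1\<close> the shape that
    the expansion rule for affine functions expects.\<close>
  define m1 m2 m3 m4 :: "real \<times> real \<times> real \<times> real \<Rightarrow> real" where
    "m1 = (\<lambda>d. 0 + fst d)" and "m2 = (\<lambda>d. 1 + fst (snd d))" and
    "m3 = (\<lambda>d. a + fst (snd (snd d)))" and "m4 = (\<lambda>d. \<kappa> + snd (snd (snd d)))"
  note lin = bounded_linear_fst bounded_linear_snd
  have m: "second_order_at_0 m1 0 fst" "second_order_at_0 m2 1 (\<lambda>d. fst (snd d))"
    "second_order_at_0 m3 a (\<lambda>d. fst (snd (snd d)))" "second_order_at_0 m4 \<kappa> (\<lambda>d. snd (snd (snd d)))"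
    unfolding m1_def m2_def m3_def m4_def
    by (intro second_order_at_0_shift bounded_linear_compose[OF bounded_linear_fst]
        bounded_linear_compose[OF bounded_linear_snd] lin)+
  note mult = second_order_at_0_mult and add = second_order_at_0_add and scale = second_order_at_0_scale
  define V S F where
    "V = (\<lambda>d. m2 d - m1 d * m1 d)" and
    "S = (\<lambda>d. m3 d + -3 * (m1 d * m2 d) + 2 * (m1 d * (m1 d * m1 d)))" and
    "F = (\<lambda>d. m4 d + -4 * (m1 d * m3 d) + 6 * ((m1 d * m1 d) * m2 d) + -3 * ((m1 d * m1 d) * (m1 d * m1 d)))"
  have V: "second_order_at_0 V 1 (\<lambda>d. fst (snd d))"
    using add[OF m(2) scale[OF mult[OF m(1) m(1)], of "-1"]] by (simp add: V_def)
  have S: "second_order_at_0 S a (\<lambda>d. fst (snd (snd d)) - 3 * fst d)"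
    using add[OF add[OF m(3) scale[OF mult[OF m(1) m(2)], of "-3"]]
        scale[OF mult[OF m(1) mult[OF m(1) m(1)]], of 2]] by (simp add: S_def)
  have F: "second_order_at_0 F \<kappa> (\<lambda>d. snd (snd (snd d)) - 4 * a * fst d)"
    using add[OF add[OF add[OF m(4) scale[OF mult[OF m(1) m(3)], of "-4"]]
        scale[OF mult[OF mult[OF m(1) m(1)] m(2)], of 6]]
        scale[OF mult[OF mult[OF m(1) m(1)] mult[OF m(1) m(1)]], of "-3"]]
    by (simp add: F_def algebra_simps)
  have I: "second_order_at_0 (\<lambda>d. inverse (V d)) 1 (\<lambda>d. - fst (snd d))"
    using second_order_at_0_inverse[OF V] by simp
  have I2: "second_order_at_0 (\<lambda>d. inverse (V d) * inverse (V d)) 1 (\<lambda>d. - 2 * fst (snd d))"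
    using mult[OF I I] by simp
  have T: "second_order_at_0
      (\<lambda>d. F d * (inverse (V d) * inverse (V d))
         + - 1 * ((S d * S d) * (inverse (V d) * (inverse (V d) * inverse (V d)))))
      (\<kappa> - a\<^sup>2)
      (\<lambda>d. snd (snd (snd d)) - 2 * a * fst (snd (snd d)) - b * fst (snd d) + 2 * a * fst d)"
    using add[OF mult[OF F I2] scale[OF mult[OF mult[OF S S] mult[OF I I2]], of "-1"]]
    by (simp add: b_def power2_eq_square algebra_simps)
  then obtain \<delta> C where \<delta>: "\<delta> > 0" and C: "C > 0"
    and bound: "\<And>d. norm d < \<delta> \<Longrightarrow> \<bar>(F d * (inverse (V d) * inverse (V d))
         + - 1 * ((S d * S d) * (inverse (V d) * (inverse (V d) * inverse (V d))))) - (\<kappa> - a\<^sup>2)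
       - (snd (snd (snd d)) - 2 * a * fst (snd (snd d)) - b * fst (snd d) + 2 * a * fst d)\<bar> \<le> C * (norm d)\<^sup>2"
    by (rule second_order_at_0_D) blast
  have "\<forall>\<^sub>F d in nhds 0. V d \<noteq> 0"
    using second_order_at_0_tendsto[OF V] by (rule tendsto_imp_eventually_ne) simp
  then obtain \<delta>' where \<delta>': "\<delta>' > 0" "\<And>d. norm d < \<delta>' \<Longrightarrow> V d \<noteq> 0"
    unfolding eventually_nhds_metric by auto
  show thesis
  proof (rule that[of "min \<delta> \<delta>'" C])
    fix c n x d1 d2 d3 d4
    assume n: "1 \<le> n" and d: "norm (d1, d2, d3, d4) < min \<delta> \<delta>'"
      and r: "raw_sample_moment 1 n x = d1" "raw_sample_moment 2 n x = 1 + d2"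
        "raw_sample_moment 3 n x = a + d3" "raw_sample_moment 4 n x = \<kappa> + d4"
    let ?d = "(d1, d2, d3, d4)"
    note csm = central_sample_moment_via_raw[OF n, of x, unfolded r]
    have csm: "central_sample_moment 2 n x = V ?d" "central_sample_moment 3 n x = S ?d"
      "central_sample_moment 4 n x = F ?d"
      by (simp_all add: csm V_def S_def F_def m1_def m2_def m3_def m4_def)
    have "T_stat c n x = F ?d * (inverse (V ?d) * inverse (V ?d))
         + - 1 * ((S ?d * S ?d) * (inverse (V ?d) * (inverse (V ?d) * inverse (V ?d))))"
      using \<delta>'(2)[of ?d] d
      by (simp add: T_stat_def csm divide_inverse power2_eq_square power3_eq_cube)
    with bound[of ?d] d show "\<bar>T_stat c n x - (\<kappa> - a\<^sup>2) - (d4 - 2 * a * d3 - b * d2 + 2 * a * d1)\<bar>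
        \<le> C * (norm ?d)\<^sup>2" by simp
  qed (use \<delta> \<delta>'(1) C in auto)
qed

section \<open>Asymptotic normality\<close>

text \<open>The function \<open>h\<close> is the influence function of the statistic: \<open>\<Sum>i=1..n. h (Y i)\<close>, divided
  by \<open>n\<close>, is exactly the linear part of the expansion at the empirical moments. The square-integrability
  of \<open>h (Y 1)\<close>, and of the deviation of the fourth raw moment, is what uses the eighth moment.\<close>

lemma (in prob_space) T_stat_standardized_asymptotically_normal:
  fixes Y :: "nat \<Rightarrow> 'a \<Rightarrow> real" and c :: "nat \<Rightarrow> real"
  assumes indep: "indep_vars (\<lambda>_. borel) Y {1..}"
    and ident: "\<And>i. 1 \<le> i \<Longrightarrow> distr M borel (Y i) = distr M borel (Y 1)"
    and int8: "integrable M (\<lambda>\<omega>. Y 1 \<omega> ^ 8)"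
    and mean: "expectation (Y 1) = 0"
    and var: "expectation (\<lambda>\<omega>. (Y 1 \<omega>)\<^sup>2) = 1"
  defines "a \<equiv> expectation (\<lambda>\<omega>. Y 1 \<omega> ^ 3)"
    and "\<kappa> \<equiv> expectation (\<lambda>\<omega>. Y 1 \<omega> ^ 4)"
  defines "b \<equiv> 2 * \<kappa> - 3 * a\<^sup>2"
  defines "h \<equiv> \<lambda>y. (y ^ 4 - \<kappa>) - 2 * a * (y ^ 3 - a) - b * (y\<^sup>2 - 1) + 2 * a * y"
  shows "weak_conv_m
      (\<lambda>n. distr M borel (\<lambda>\<omega>. sqrt (real n) * (T_stat (c n) n (\<lambda>i. Y i \<omega>) - (\<kappa> - a\<^sup>2))))
      (normal_law 0 (expectation (\<lambda>\<omega>. (h (Y 1 \<omega>))\<^sup>2)))"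
proof (rule weak_conv_m_asymptotically_equal)
  have rv[measurable]: "random_variable borel (Y i)" if "1 \<le> i" for i
    using indep that unfolding indep_vars_def2 by auto
  have [measurable]: "random_variable borel (Y (Suc 0))" by (rule rv) simp
  have h_meas[measurable]: "h \<in> borel_measurable borel" by (simp add: h_def)
  have moments: "integrable M (\<lambda>\<omega>. Y 1 \<omega> ^ k)" if "k \<le> 8" for k
    using int8 that by (rule integrable_power_le[of "Y 1" 8, rotated]) simp
  define \<nu> where "\<nu> k = expectation (\<lambda>\<omega>. Y 1 \<omega> ^ k)" for k
  have \<nu>: "\<nu> 1 = 0" "\<nu> 2 = 1" "\<nu> 3 = a" "\<nu> 4 = \<kappa>"
    by (simp_all add: \<nu>_def a_def \<kappa>_def var mean flip: One_nat_def)
  \<comment> \<open>The centred powers, and below their sample means \<open>d k n\<close>: the deviations of the raw sample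
    moments from the population moments.\<close>
  define W where "W k i \<omega> = Y i \<omega> ^ k - \<nu> k" for k i \<omega>
  have W_rv: "random_variable borel (W k i)" if "1 \<le> i" for k i
    using rv[OF that] by (simp add: W_def[abs_def])
  have W_indep: "indep_vars (\<lambda>_. borel) (W k) {1..}" for k
    unfolding W_def[abs_def] by (rule indep_vars_compose2[OF indep]) auto
  have transfer: "integrable M (\<lambda>\<omega>. f (Y i \<omega>)) \<longleftrightarrow> integrable M (\<lambda>\<omega>. f (Y 1 \<omega>))"
      "expectation (\<lambda>\<omega>. f (Y i \<omega>)) = expectation (\<lambda>\<omega>. f (Y 1 \<omega>))"
    if "1 \<le> i" and [measurable]: "f \<in> borel_measurable borel" for f :: "real \<Rightarrow> real" and i
    using identically_distributed_transfer[OF rv[OF that(1)] rv[of 1] that(2) ident[OF that(1)]] by simp_all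
  have W_mean: "expectation (W k i) = 0" if "1 \<le> i" "k \<le> 8" for k i
    using transfer(2)[OF that(1), of "\<lambda>y. y ^ k - \<nu> k"] moments[OF that(2)]
    by (simp add: W_def[abs_def] \<nu>_def prob_space)
  have W_sq1: "integrable M (\<lambda>\<omega>. (W k 1 \<omega>)\<^sup>2)" if "k \<le> 4" for k
  proof -
    have "integrable M (\<lambda>\<omega>. Y 1 \<omega> ^ (2 * k) - 2 * \<nu> k * Y 1 \<omega> ^ k + (\<nu> k)\<^sup>2)"
      using that by (intro Bochner_Integration.integrable_add Bochner_Integration.integrable_diff
          integrable_mult_right moments) auto
    moreover have "(W k 1 \<omega>)\<^sup>2 = Y 1 \<omega> ^ (2 * k) - 2 * \<nu> k * Y 1 \<omega> ^ k + (\<nu> k)\<^sup>2" for \<omega>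
      by (simp add: W_def power2_diff algebra_simps flip: power_mult)
    ultimately show ?thesis by simp
  qed
  have W_sq: "integrable M (\<lambda>\<omega>. (W k i \<omega>)\<^sup>2)"
    "expectation (\<lambda>\<omega>. (W k i \<omega>)\<^sup>2) = expectation (\<lambda>\<omega>. (W k 1 \<omega>)\<^sup>2)" if "1 \<le> i" "k \<le> 4" for k i
    using transfer[OF that(1), of "\<lambda>y. (y ^ k - \<nu> k)\<^sup>2"] W_sq1[OF that(2)] by (simp_all add: W_def)
  define d where "d k n \<omega> = (\<Sum>i=1..n. W k i \<omega>) / real n" for k n \<omega>
  have d_rv[measurable]: "random_variable borel (d k n)" for k n
    unfolding d_def[abs_def] by (intro borel_measurable_divide borel_measurable_sum W_rv) auto
  have d_sq: "integrable M (\<lambda>\<omega>. (d k n \<omega>)\<^sup>2)"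
    "expectation (\<lambda>\<omega>. (d k n \<omega>)\<^sup>2) = expectation (\<lambda>\<omega>. (W k 1 \<omega>)\<^sup>2) / real n" if "k \<le> 4" for k n
  proof -
    note second = indep_sum_second_moment[of "{1..n}" "W k", OF _ indep_vars_subset[OF W_indep]]
    have int: "integrable M (\<lambda>\<omega>. (\<Sum>i=1..n. W k i \<omega>)\<^sup>2)"
      by (rule second(1)) (use W_sq(1) W_mean that in auto)
    have "expectation (\<lambda>\<omega>. (\<Sum>i=1..n. W k i \<omega>)\<^sup>2) = (\<Sum>i=1..n. expectation (\<lambda>\<omega>. (W k i \<omega>)\<^sup>2))"
      by (rule second(2)) (use W_sq(1) W_mean that in auto)
    also have "\<dots> = (\<Sum>i=1..n. expectation (\<lambda>\<omega>. (W k 1 \<omega>)\<^sup>2))"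
      by (intro sum.cong W_sq(2) that) auto
    also have "\<dots> = real n * expectation (\<lambda>\<omega>. (W k 1 \<omega>)\<^sup>2)" by simp
    finally have exp: "expectation (\<lambda>\<omega>. (\<Sum>i=1..n. W k i \<omega>)\<^sup>2)
        = real n * expectation (\<lambda>\<omega>. (W k 1 \<omega>)\<^sup>2)" .
    show "integrable M (\<lambda>\<omega>. (d k n \<omega>)\<^sup>2)"
      unfolding d_def power_divide using int by (rule integrable_divide)
    show "expectation (\<lambda>\<omega>. (d k n \<omega>)\<^sup>2) = expectation (\<lambda>\<omega>. (W k 1 \<omega>)\<^sup>2) / real n"
      unfolding d_def power_divide integral_divide_zero exp
      by (simp only: power2_eq_square[of "real n"]) simp
  qed
  define D where "D n \<omega> = (d 1 n \<omega>, d 2 n \<omega>, d 3 n \<omega>, d 4 n \<omega>)" for n \<omega>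
  define K where "K = expectation (\<lambda>\<omega>. (W 1 1 \<omega>)\<^sup>2) + expectation (\<lambda>\<omega>. (W 2 1 \<omega>)\<^sup>2)
    + expectation (\<lambda>\<omega>. (W 3 1 \<omega>)\<^sup>2) + expectation (\<lambda>\<omega>. (W 4 1 \<omega>)\<^sup>2)"
  have D_norm: "(norm (D n \<omega>))\<^sup>2 = (d 1 n \<omega>)\<^sup>2 + (d 2 n \<omega>)\<^sup>2 + (d 3 n \<omega>)\<^sup>2 + (d 4 n \<omega>)\<^sup>2" for n \<omega>
    by (simp add: D_def norm_Pair)
  have D_int: "integrable M (\<lambda>\<omega>. (norm (D n \<omega>))\<^sup>2)" for n
    unfolding D_norm by (intro Bochner_Integration.integrable_add d_sq) auto
  have D_exp: "expectation (\<lambda>\<omega>. (norm (D n \<omega>))\<^sup>2) \<le> K / real n" for n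
    unfolding D_norm using d_sq by (simp add: K_def add_divide_distrib)
  have raw: "raw_sample_moment k n (\<lambda>i. Y i \<omega>) = \<nu> k + d k n \<omega>" if "1 \<le> n" for k n \<omega>
    using that by (simp add: raw_sample_moment_def d_def W_def sum_subtractf field_simps)

  let ?T = "\<lambda>n \<omega>. T_stat (c n) n (\<lambda>i. Y i \<omega>)"
  let ?l = "\<lambda>n \<omega>. d 4 n \<omega> - 2 * a * d 3 n \<omega> - b * d 2 n \<omega> + 2 * a * d 1 n \<omega>"
  let ?U = "\<lambda>n \<omega>. (\<Sum>i=1..n. h (Y i \<omega>)) / sqrt (real n)"
  have [measurable]: "(\<lambda>\<omega>. sample_mean n (\<lambda>i. Y i \<omega>)) \<in> borel_measurable M" for n
    unfolding sample_mean_def by (intro borel_measurable_divide borel_measurable_sum rv) auto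
  have [measurable]: "(\<lambda>\<omega>. central_sample_moment k n (\<lambda>i. Y i \<omega>)) \<in> borel_measurable M" for k n
    unfolding central_sample_moment_def
    by (intro borel_measurable_divide borel_measurable_sum borel_measurable_power borel_measurable_diff rv) auto
  have T_rv[measurable]: "random_variable borel (?T n)" for n
    unfolding T_stat_def by measurable
  show "random_variable borel (\<lambda>\<omega>. sqrt (real n) * (?T n \<omega> - (\<kappa> - a\<^sup>2)))" for n
    by measurable
  have hY[measurable]: "random_variable borel (\<lambda>\<omega>. h (Y i \<omega>))" if "1 \<le> i" for i
    using rv[OF that] by measurable
  show "random_variable borel (?U n)" for n
    by (intro borel_measurable_divide borel_measurable_sum hY) auto
  show "real_distribution (normal_law 0 (expectation (\<lambda>\<omega>. (h (Y 1 \<omega>))\<^sup>2)))"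
    by (intro real_distribution_normal_law integral_nonneg) simp

  have h_W: "h (Y i \<omega>) = W 4 i \<omega> - 2 * a * W 3 i \<omega> - b * W 2 i \<omega> + 2 * a * W 1 i \<omega>" for i \<omega>
    using \<nu> by (simp add: h_def W_def)
  show "weak_conv_m (\<lambda>n. distr M borel (?U n)) (normal_law 0 (expectation (\<lambda>\<omega>. (h (Y 1 \<omega>))\<^sup>2)))"
  proof (rule central_limit_theorem_possibly_degenerate)
    show "indep_vars (\<lambda>_. borel) (\<lambda>i \<omega>. h (Y i \<omega>)) {1..}"
      by (rule indep_vars_compose2[OF indep]) simp
    show "distr M borel (\<lambda>\<omega>. h (Y i \<omega>)) = distr M borel (\<lambda>\<omega>. h (Y 1 \<omega>))" if "1 \<le> i" for i
      using distr_distr[of h borel borel "Y i" M] distr_distr[of h borel borel "Y 1" M]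
        rv[OF that] rv[of 1] ident[OF that] by (simp add: comp_def)
    have W_int: "integrable M (W k 1)" if "k \<le> 4" for k
      by (rule square_integrable_imp_integrable[OF W_rv W_sq1[OF that]]) simp
    show "expectation (\<lambda>\<omega>. h (Y 1 \<omega>)) = 0"
      unfolding h_W using W_int W_mean by simp
    show "integrable M (\<lambda>\<omega>. (h (Y 1 \<omega>))\<^sup>2)"
    proof (rule Bochner_Integration.integrable_bound)
      show "integrable M (\<lambda>\<omega>. 4 * ((W 4 1 \<omega>)\<^sup>2 + (2 * a)\<^sup>2 * (W 3 1 \<omega>)\<^sup>2 + b\<^sup>2 * (W 2 1 \<omega>)\<^sup>2
          + (2 * a)\<^sup>2 * (W 1 1 \<omega>)\<^sup>2))"
        by (intro integrable_mult_right Bochner_Integration.integrable_add W_sq1) auto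
      have "(p - q - r + s)\<^sup>2 \<le> 4 * (p\<^sup>2 + q\<^sup>2 + r\<^sup>2 + s\<^sup>2)" for p q r s :: real
      proof -
        \<comment> \<open>Lagrange's identity: the difference is a sum of six squares.\<close>
        have "4 * (p\<^sup>2 + q\<^sup>2 + r\<^sup>2 + s\<^sup>2) - (p - q - r + s)\<^sup>2
            = (p + q)\<^sup>2 + (p + r)\<^sup>2 + (p - s)\<^sup>2 + (q - r)\<^sup>2 + (q + s)\<^sup>2 + (r + s)\<^sup>2"
          by (simp add: power2_eq_square algebra_simps)
        then show ?thesis by (smt (verit) zero_le_power2)
      qed
      from this[of "W 4 1 \<omega>" "2 * a * W 3 1 \<omega>" "b * W 2 1 \<omega>" "2 * a * W 1 1 \<omega>" for \<omega>]
      show "AE \<omega> in M. norm ((h (Y 1 \<omega>))\<^sup>2) \<le> norm (4 * ((W 4 1 \<omega>)\<^sup>2 + (2 * a)\<^sup>2 * (W 3 1 \<omega>)\<^sup>2 + b\<^sup>2 * (W 2 1 \<omega>)\<^sup>2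
          + (2 * a)\<^sup>2 * (W 1 1 \<omega>)\<^sup>2))"
        unfolding h_W by (intro AE_I2) (simp add: power_mult_distrib)
    qed simp
  qed

  obtain \<delta> C where \<delta>C: "\<delta> > 0" "C > 0"
    and expansion: "\<And>c n x d1 d2 d3 d4. 1 \<le> n \<Longrightarrow> norm (d1, d2, d3, d4) < \<delta> \<Longrightarrow>
      raw_sample_moment 1 n x = d1 \<Longrightarrow> raw_sample_moment 2 n x = 1 + d2 \<Longrightarrow>
      raw_sample_moment 3 n x = a + d3 \<Longrightarrow> raw_sample_moment 4 n x = \<kappa> + d4 \<Longrightarrow>
      \<bar>T_stat c n x - (\<kappa> - a\<^sup>2) - (d4 - 2 * a * d3 - b * d2 + 2 * a * d1)\<bar>
        \<le> C * (norm (d1, d2, d3, d4))\<^sup>2"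
    using T_stat_expansion[of a \<kappa>] unfolding b_def by blast
  have linear_part: "sqrt (real n) * ?l n \<omega> = ?U n \<omega>" for n \<omega>
  proof (cases "n = 0")
    case False
    have "?l n \<omega> = (\<Sum>i=1..n. h (Y i \<omega>)) / real n"
      unfolding d_def h_W by (simp add: sum.distrib sum_subtractf add_divide_distrib
          diff_divide_distrib flip: sum_distrib_left)
    moreover have "sqrt (real n) * (s / real n) = s / sqrt (real n)" for s
      using False by (simp add: divide_simps)
    ultimately show ?thesis by simp
  qed simp
  fix \<epsilon> :: real assume "\<epsilon> > 0"
  have "(\<lambda>n. prob {\<omega>\<in>space M. \<epsilon> \<le> \<bar>sqrt (real n) * (?T n \<omega> - (\<kappa> - a\<^sup>2) - ?l n \<omega>)\<bar>}) \<longlonglongrightarrow> 0"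
  proof (rule sqrt_times_quadratic_remainder_vanishes[OF _ D_int D_exp \<delta>C _ \<open>\<epsilon> > 0\<close>])
    show "random_variable borel (\<lambda>\<omega>. ?T n \<omega> - (\<kappa> - a\<^sup>2) - ?l n \<omega>)" for n by measurable
    show "\<bar>?T n \<omega> - (\<kappa> - a\<^sup>2) - ?l n \<omega>\<bar> \<le> C * (norm (D n \<omega>))\<^sup>2"
      if "1 \<le> n" "norm (D n \<omega>) < \<delta>" for n \<omega>
      using that raw[OF that(1)] \<nu> unfolding D_def by (intro expansion) auto
  qed
  moreover have "sqrt (real n) * (?T n \<omega> - (\<kappa> - a\<^sup>2) - ?l n \<omega>)
      = sqrt (real n) * (?T n \<omega> - (\<kappa> - a\<^sup>2)) - ?U n \<omega>" for n \<omega>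
    unfolding linear_part[symmetric] by (simp add: algebra_simps)
  ultimately show "(\<lambda>n. prob {\<omega>\<in>space M.
      \<epsilon> \<le> \<bar>sqrt (real n) * (?T n \<omega> - (\<kappa> - a\<^sup>2)) - ?U n \<omega>\<bar>}) \<longlonglongrightarrow> 0" by simp
qed

text \<open>The limit variance is the second moment of the influence function. Written in powers of \<open>y\<close>, the
  influence function is \<open>y^4 - 2 a y^3 - b y^2 + 2 a y + \<Delta>\<close> with \<open>a = \<nu> 3\<close> and \<open>b = 2 \<Delta> - a^2\<close>;
  squaring it gives a polynomial of degree eight, and the formula in terms of \<open>\<Delta>\<close> results from
  substituting \<open>\<nu> 4 = \<Delta> + a^2\<close>.\<close>

lemma (in prob_space) T_stat_limit_variance:
  fixes Y :: "'a \<Rightarrow> real"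
  assumes int: "\<And>k. k \<le> 8 \<Longrightarrow> integrable M (\<lambda>\<omega>. Y \<omega> ^ k)"
    and \<nu>: "\<And>k. k \<le> 8 \<Longrightarrow> expectation (\<lambda>\<omega>. Y \<omega> ^ k) = \<nu> k" and \<nu>12: "\<nu> 1 = 0" "\<nu> 2 = 1"
    and \<Delta>: "\<Delta> = \<nu> 4 - (\<nu> 3)\<^sup>2"
  shows "expectation (\<lambda>\<omega>. ((Y \<omega> ^ 4 - \<nu> 4) - 2 * \<nu> 3 * (Y \<omega> ^ 3 - \<nu> 3)
            - (2 * \<nu> 4 - 3 * (\<nu> 3)\<^sup>2) * ((Y \<omega>)\<^sup>2 - 1) + 2 * \<nu> 3 * Y \<omega>)\<^sup>2)
       = 4 * \<Delta> ^ 3 - \<Delta>\<^sup>2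
           - (3 * \<nu> 3 ^ 4 + 16 * (\<nu> 3)\<^sup>2 - 8 * \<nu> 3 * \<nu> 5 + 4 * \<nu> 6) * \<Delta>
           + \<nu> 3 ^ 6 - 4 * \<nu> 3 ^ 4 - 4 * \<nu> 3 ^ 3 * \<nu> 5
           + 2 * (\<nu> 3)\<^sup>2 * (2 + 3 * \<nu> 6) + 4 * \<nu> 3 * (\<nu> 5 - \<nu> 7) + \<nu> 8"
proof -
  define a where "a = \<nu> 3"
  define b where "b = 2 * \<Delta> - a\<^sup>2"
  have \<nu>4: "\<nu> 4 = \<Delta> + a\<^sup>2" using \<Delta> by (simp add: a_def)
  \<comment> \<open>The coefficients of the squared influence function.\<close>
  define q where "q k = (if k = 8 then 1 else if k = 7 then - 4 * a else if k = 6 then 4 * a\<^sup>2 - 2 * b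
     else if k = 5 then 4 * a + 4 * a * b else if k = 4 then b\<^sup>2 - 8 * a\<^sup>2 + 2 * \<Delta>
     else if k = 3 then - 4 * a * b - 4 * a * \<Delta> else if k = 2 then 4 * a\<^sup>2 - 2 * b * \<Delta>
     else if k = 1 then 4 * a * \<Delta> else \<Delta>\<^sup>2)" for k :: nat
  have sum8: "(\<Sum>k\<le>8. f k) = f 0 + f 1 + f 2 + f 3 + f 4 + f 5 + f 6 + f 7 + f 8" for f :: "nat \<Rightarrow> real"
    by (simp add: eval_nat_numeral)
  have "((y ^ 4 - \<nu> 4) - 2 * \<nu> 3 * (y ^ 3 - \<nu> 3) - (2 * \<nu> 4 - 3 * (\<nu> 3)\<^sup>2) * (y\<^sup>2 - 1) + 2 * \<nu> 3 * y)\<^sup>2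
      = (\<Sum>k\<le>8. q k * y ^ k)" for y :: real
    unfolding sum8 \<nu>4 a_def[symmetric] by (simp add: q_def b_def) algebra
  then have "expectation (\<lambda>\<omega>. ((Y \<omega> ^ 4 - \<nu> 4) - 2 * \<nu> 3 * (Y \<omega> ^ 3 - \<nu> 3)
            - (2 * \<nu> 4 - 3 * (\<nu> 3)\<^sup>2) * ((Y \<omega>)\<^sup>2 - 1) + 2 * \<nu> 3 * Y \<omega>)\<^sup>2) = (\<Sum>k\<le>8. q k * \<nu> k)"
    using int \<nu> by simp
  also have "\<dots> = q 0 + q 2 + q 3 * a + q 4 * (\<Delta> + a\<^sup>2) + q 5 * \<nu> 5 + q 6 * \<nu> 6 + q 7 * \<nu> 7 + q 8 * \<nu> 8"
    using \<nu>[of 0] unfolding sum8 \<nu>12 \<nu>4 a_def[symmetric] by (simp add: prob_space)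
  also have "\<dots> = 4 * \<Delta> ^ 3 - \<Delta>\<^sup>2
           - (3 * a ^ 4 + 16 * a\<^sup>2 - 8 * a * \<nu> 5 + 4 * \<nu> 6) * \<Delta>
           + a ^ 6 - 4 * a ^ 4 - 4 * a ^ 3 * \<nu> 5
           + 2 * a\<^sup>2 * (2 + 3 * \<nu> 6) + 4 * a * (\<nu> 5 - \<nu> 7) + \<nu> 8"
    unfolding q_def b_def by simp algebra
  finally show ?thesis unfolding a_def .
qed

theorem theorem2p1:
  fixes M :: "'a measure"
    and X :: "'a \<Rightarrow> real" and Xs :: "nat \<Rightarrow> 'a \<Rightarrow> real"
    and \<mu> \<sigma> \<tau> \<kappa> \<Delta> varsigma2 :: real and \<nu> :: "nat \<Rightarrow> real" and c :: "nat \<Rightarrow> real"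
  assumes "prob_space M"
    and "X \<in> borel_measurable M"
    and "prob_space.indep_vars M (\<lambda>_. borel) Xs {1..}"
    and "\<And>i. 1 \<le> i \<Longrightarrow> distr M borel (Xs i) = distr M borel X"
    and "integrable M (\<lambda>\<omega>. X \<omega> ^ 8)"
    and "prob_space.expectation M X = \<mu>"
    and "prob_space.variance M X = \<sigma>\<^sup>2"
    and "\<sigma> > 0"
    and "\<And>k. k \<le> 8 \<Longrightarrow> \<nu> k = prob_space.expectation M (\<lambda>\<omega>. ((X \<omega> - \<mu>) / \<sigma>) ^ k)"
    and "\<tau> = \<nu> 3"
    and "\<kappa> = \<nu> 4"
    and "\<Delta> = \<kappa> - \<tau>\<^sup>2"
    and "varsigma2 = 4 * \<Delta> ^ 3 - \<Delta>\<^sup>2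
           - (3 * \<nu> 3 ^ 4 + 16 * (\<nu> 3)\<^sup>2 - 8 * \<nu> 3 * \<nu> 5 + 4 * \<nu> 6) * \<Delta>
           + \<nu> 3 ^ 6 - 4 * \<nu> 3 ^ 4 - 4 * \<nu> 3 ^ 3 * \<nu> 5
           + 2 * (\<nu> 3)\<^sup>2 * (2 + 3 * \<nu> 6) + 4 * \<nu> 3 * (\<nu> 5 - \<nu> 7) + \<nu> 8"
  shows "0 \<le> varsigma2 \<and>
         weak_conv_m
           (\<lambda>n. distr M borel (\<lambda>\<omega>. sqrt (real n) * (T_stat (c n) n (\<lambda>i. Xs i \<omega>) - \<Delta>)))
           (normal_law 0 varsigma2)"
proof -
  interpret prob_space M by fact
  note [measurable] = assms(2)
  have Xs_rv: "random_variable borel (Xs i)" if "1 \<le> i" for i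
    using assms(3) that unfolding indep_vars_def2 by auto
  \<comment> \<open>Standardise the observations; the population moments \<open>\<nu>\<close> are the moments of \<open>s X\<close>.\<close>
  define s where "s x = (x - \<mu>) / \<sigma>" for x
  have s_meas[measurable]: "s \<in> borel_measurable borel" by (simp add: s_def[abs_def])
  define Y where "Y i \<omega> = s (Xs i \<omega>)" for i \<omega>
  have Y_indep: "indep_vars (\<lambda>_. borel) Y {1..}"
    unfolding Y_def[abs_def] by (rule indep_vars_compose2[OF assms(3)]) simp
  have Y_distr: "distr M borel (Y i) = distr M borel (\<lambda>\<omega>. s (X \<omega>))" if "1 \<le> i" for i
    using distr_distr[of s borel borel "Xs i" M] distr_distr[of s borel borel X M]
      Xs_rv[OF that] assms(4)[OF that] by (simp add: comp_def Y_def[abs_def])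
  have Y1_rv: "random_variable borel (Y 1)"
    using Y_indep unfolding indep_vars_def2 by auto
  have transfer: "integrable M (\<lambda>\<omega>. Y 1 \<omega> ^ k) \<longleftrightarrow> integrable M (\<lambda>\<omega>. s (X \<omega>) ^ k)"
      "expectation (\<lambda>\<omega>. Y 1 \<omega> ^ k) = expectation (\<lambda>\<omega>. s (X \<omega>) ^ k)" for k
    using identically_distributed_transfer[of "Y 1" "\<lambda>\<omega>. s (X \<omega>)" "\<lambda>y. y ^ k"] Y1_rv Y_distr by auto
  have X_int: "integrable M (\<lambda>\<omega>. X \<omega> ^ k)" if "k \<le> 8" for k
    using assms(2,5) that by (rule integrable_power_le)
  have Y_int: "integrable M (\<lambda>\<omega>. Y 1 \<omega> ^ k)" if "k \<le> 8" for k
  proof -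
    have "integrable M (\<lambda>\<omega>. (\<Sum>j\<le>k. of_nat (k choose j) * X \<omega> ^ j * (- \<mu>) ^ (k - j)) / \<sigma> ^ k)"
      using that by (intro integrable_divide Bochner_Integration.integrable_sum
          integrable_mult_left integrable_mult_right X_int) auto
    then have "integrable M (\<lambda>\<omega>. (X \<omega> + - \<mu>) ^ k / \<sigma> ^ k)"
      by (simp only: binomial_ring)
    then show ?thesis unfolding transfer(1) by (simp add: s_def power_divide)
  qed
  have Y_mom: "expectation (\<lambda>\<omega>. Y 1 \<omega> ^ k) = \<nu> k" if "k \<le> 8" for k
    using assms(9)[OF that] unfolding transfer(2) by (simp add: s_def)
  have "integrable M X" using X_int[of 1] by simp
  then have \<nu>1: "\<nu> 1 = 0" using assms(6) assms(9)[of 1] by (simp add: prob_space)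
  have \<nu>2: "\<nu> 2 = 1" using assms(6,7,8) assms(9)[of 2] by (simp add: power_divide)
  define h where "h = (\<lambda>y. (y ^ 4 - \<nu> 4) - 2 * \<nu> 3 * (y ^ 3 - \<nu> 3)
            - (2 * \<nu> 4 - 3 * (\<nu> 3)\<^sup>2) * (y\<^sup>2 - 1) + 2 * \<nu> 3 * y)"
  have variance_eq: "expectation (\<lambda>\<omega>. (h (Y 1 \<omega>))\<^sup>2) = varsigma2"
    using T_stat_limit_variance[of "Y 1" \<nu> \<Delta>, OF Y_int Y_mom \<nu>1 \<nu>2] assms(10-13) by (simp add: h_def)
  have "weak_conv_m
      (\<lambda>n. distr M borel (\<lambda>\<omega>. sqrt (real n) * (T_stat (c n) n (\<lambda>i. Y i \<omega>) - \<Delta>)))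
      (normal_law 0 varsigma2)"
    using T_stat_standardized_asymptotically_normal[OF Y_indep, of c] Y_distr Y_int[of 8] Y_mom[of 1]
      Y_mom[of 2] Y_mom[of 3] Y_mom[of 4] \<nu>1 \<nu>2 assms(10-12) variance_eq
    by (simp add: h_def)
  moreover have "sqrt (real n) * (T_stat (c n) n (\<lambda>i. Y i \<omega>) - \<Delta>)
      = sqrt (real n) * (T_stat (c n) n (\<lambda>i. Xs i \<omega>) - \<Delta>)" for n \<omega>
  \<comment> \<open>For \<open>n = 0\<close> the factor \<open>sqrt n\<close> vanishes on both sides.\<close>
  proof (cases "n = 0")
    case False
    then have "T_stat (c n) n (\<lambda>i. Xs i \<omega>) = T_stat (c n) n (\<lambda>i. Y i \<omega>)"
      using assms(8) by (intro T_stat_affine_invariant[of n \<sigma> _ \<mu>]) (auto simp: Y_def s_def)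
    then show ?thesis by simp
  qed simp
  moreover have "0 \<le> varsigma2" unfolding variance_eq[symmetric] by simp
  ultimately show ?thesis by simp
qed

end
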